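(* Let $(X,\triangleright)$ be a Płonka sum of racks $(X_\alpha,\triangleright_\alpha)$ indexed by a (lower) semilattice $Y$, with connecting rack homomorphisms $\phi_{\alpha,\beta}$ ($\alpha\ge\beta$). Then the solution $r_\triangleright(x,y)=\left(L^0_x(y),\,L_y(x)\right)$ associated to $(X,\triangleright)$ is the strong semilattice of the derived solutions $(X_\alpha,r_\alpha)$ associated to each rack $X_\alpha$. In particular, $$r_\triangleright(a,b)=r_{\alpha\beta}\left(\phi_{\alpha,\alpha\beta}(a),\phi_{\beta,\alpha\beta}(b)\right)$$ for all $a\in X_\alpha$, $b\in X_\beta$.
   Context: Juxtaposition of maps denotes composition. A (left) shelf $(X,\triangleright)$ is a set with a binary operation such that $x\triangleright(y\triangleright z)=(x\triangleright y)\triangleright(x\triangleright z)$ for all $x,y,z$; write $L_x(y)=x\triangleright y$. A rack is a shelf with all $L_x$ bijective. If $L_x$ admits a map $L_x^-:X\to X$ with $L_xL_x^-L_x=L_x$, $L_x^-L_xL_x^-=L_x^-$, $L_xL_x^-=L_x^-L_x$, then $L_x^-$ is unique and $L^0_x:=L_xL_x^-$. In a Płonka sum of racks (defined next) such an $L_x^-$ exists for every $x$. Płonka sum of racks: let $Y$ be a (lower) semilattice (meet written as product $\alpha\beta$, with $\alpha\ge\beta$ iff $\alpha\beta=\beta$) and $\{(X_\alpha,\triangleright_\alpha)\mid\alpha\in Y\}$ a family of disjoint racks. For all $\alpha\ge\beta$ in $Y$ let $\phi_{\alpha,\beta}:X_\alpha\to X_\beta$ be a rack homomorphism such that $\phi_{\alpha,\alpha}=\mathrm{id}_{X_\alpha}$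 for all $\alpha$ and $\phi_{\beta,\gamma}\phi_{\alpha,\beta}=\phi_{\alpha,\gamma}$ whenever $\alpha\ge\beta\ge\gamma$. On $X=\bigcup_{\alpha\in Y}X_\alpha$ set $a\triangleright b:=\phi_{\alpha,\alpha\beta}(a)\triangleright_{\alpha\beta}\phi_{\beta,\alpha\beta}(b)$ for $a\in X_\alpha$, $b\in X_\beta$. The resulting shelf $(X,\triangleright)$ is the Płonka sum. A solution is a pair $(X,r)$ with $r:X\times X\to X\times X$ satisfying $(r\times\mathrm{id}_X)(\mathrm{id}_X\times r)(r\times\mathrm{id}_X)=(\mathrm{id}_X\times r)(r\times\mathrm{id}_X)(\mathrm{id}_X\times r)$. The derived solution of a rack $(X_\alpha,\triangleright_\alpha)$ is $r_\alpha(x,y)=(y,\,y\triangleright_\alpha x)$. Strong semilattice of solutions: given a (lower) semilattice $Y$, disjoint solutions $(X_\alpha,r_\alpha)$, $\alpha\in Y$, and maps $\phi_{\alpha,\beta}:X_\alpha\to X_\beta$ for $\alpha\ge\beta$ with $\phi_{\alpha,\alpha}=\mathrm{id}_{X_\alpha}$, $\phi_{\beta,\gamma}\phi_{\alpha,\beta}=\phi_{\alpha,\gamma}$ for $\alpha\ge\beta\ge\gamma$, and $(\phi_{\alpha,\beta}\times\phi_{\alpha,\beta})r_\alpha=r_\beta(\phi_{\alpha,\beta}\times\phi_{\alpha,\beta})$ for $\alpha\ge\beta$, the strong semilattice of the solutions $(X_\alpha,r_\alpha)$ is the solution on $\bigcup_\alpha X_\alpha$ given by $r(a,b)=r_{\alpha\beta}(\phi_{\alpha,\alpha\beta}(a),\phi_{\beta,\alpha\beta}(b))$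 for $a\in X_\alpha$, $b\in X_\beta$. Here the maps used are the rack homomorphisms $\phi_{\alpha,\beta}$ of the Płonka sum. *)

theory Defs
  imports "HOL-Library.FuncSet" "HOL-Library.Disjoint_Sets"
begin

text \<open>
  Structures live on explicit, possibly empty carriers \<open>S\<close>; operations and maps are total
  functions of which only the values on the carrier matter. The meet \<open>\<alpha>\<beta>\<close> of the
  indexing semilattice is \<^term>\<open>inf \<alpha> \<beta>\<close>.
\<close>

locale shelf =
  fixes S :: "'a set" and op :: "'a \<Rightarrow> 'a \<Rightarrow> 'a"
  assumes closed: "x \<in> S \<Longrightarrow> y \<in> S \<Longrightarrow> op x y \<in> S"
    and self_distrib:
      "x \<in> S \<Longrightarrow> y \<in> S \<Longrightarrow> z \<in> S \<Longrightarrow> op x (op y z) = op (op x y) (op x z)"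

locale rack = shelf +
  assumes bij: "x \<in> S \<Longrightarrow> bij_betw (op x) S S"

definition r12 :: "('a \<times> 'a \<Rightarrow> 'a \<times> 'a) \<Rightarrow> 'a \<times> 'a \<times> 'a \<Rightarrow> 'a \<times> 'a \<times> 'a" where
  "r12 r = (\<lambda>(x, y, z). let (u, v) = r (x, y) in (u, v, z))"

definition r23 :: "('a \<times> 'a \<Rightarrow> 'a \<times> 'a) \<Rightarrow> 'a \<times> 'a \<times> 'a \<Rightarrow> 'a \<times> 'a \<times> 'a" where
  "r23 r = map_prod id r"

locale solution =
  fixes S :: "'a set" and r :: "'a \<times> 'a \<Rightarrow> 'a \<times> 'a"
  assumes maps: "r \<in> S \<times> S \<rightarrow> S \<times> S"
    and yang_baxter: "t \<in> S \<times> S \<times> S \<Longrightarrow> r12 r (r23 r (r12 r t)) = r23 r (r12 r (r23 r t))"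

definition derived_solution :: "('a \<Rightarrow> 'a \<Rightarrow> 'a) \<Rightarrow> 'a \<times> 'a \<Rightarrow> 'a \<times> 'a" where
  "derived_solution op = (\<lambda>(x, y). (y, op y x))"

text \<open>
  \<open>f\<^sup>-\<close> for a self-map \<open>f\<close> of \<open>S\<close>. Extensionality (the value is \<^const>\<open>undefined\<close>
  outside \<open>S\<close>) makes uniqueness on \<open>S\<close> into uniqueness as a HOL function.
\<close>

definition is_relative_inverse :: "'a set \<Rightarrow> ('a \<Rightarrow> 'a) \<Rightarrow> ('a \<Rightarrow> 'a) \<Rightarrow> bool" where
  "is_relative_inverse S f g \<longleftrightarrow> g \<in> S \<rightarrow>\<^sub>E S \<and>
     (\<forall>y\<in>S. f (g (f y)) = f y \<and> g (f (g y)) = g y \<and> f (g y) = g (f y))"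

definition relative_inverse :: "'a set \<Rightarrow> ('a \<Rightarrow> 'a) \<Rightarrow> 'a \<Rightarrow> 'a" where
  "relative_inverse S f = (THE g. is_relative_inverse S f g)"

definition L0 :: "'a set \<Rightarrow> ('a \<Rightarrow> 'a \<Rightarrow> 'a) \<Rightarrow> 'a \<Rightarrow> 'a \<Rightarrow> 'a" where
  "L0 S op x y = op x (relative_inverse S (op x) y)"

definition associated_solution :: "'a set \<Rightarrow> ('a \<Rightarrow> 'a \<Rightarrow> 'a) \<Rightarrow> 'a \<times> 'a \<Rightarrow> 'a \<times> 'a" where
  "associated_solution S op = (\<lambda>(x, y). (L0 S op x y, op y x))"

locale semilattice_system =
  fixes X :: "'i::semilattice_inf \<Rightarrow> 'a set"
    and \<phi> :: "'i \<Rightarrow> 'i \<Rightarrow> 'a \<Rightarrow> 'a"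
  assumes disjoint: "disjoint_family X"
    and connecting_maps: "\<beta> \<le> \<alpha> \<Longrightarrow> \<phi> \<alpha> \<beta> \<in> X \<alpha> \<rightarrow> X \<beta>"
    and connecting_id: "x \<in> X \<alpha> \<Longrightarrow> \<phi> \<alpha> \<alpha> x = x"
    and connecting_comp:
      "\<gamma> \<le> \<beta> \<Longrightarrow> \<beta> \<le> \<alpha> \<Longrightarrow> x \<in> X \<alpha> \<Longrightarrow> \<phi> \<beta> \<gamma> (\<phi> \<alpha> \<beta> x) = \<phi> \<alpha> \<gamma> x"

definition component_index :: "('i \<Rightarrow> 'a set) \<Rightarrow> 'a \<Rightarrow> 'i" where
  "component_index X a = (THE \<alpha>. a \<in> X \<alpha>)"

locale rack_system = semilattice_system X \<phi>
  for X :: "'i::semilattice_inf \<Rightarrow> 'a set" and \<phi> :: "'i \<Rightarrow> 'i \<Rightarrow> 'a \<Rightarrow> 'a" +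
  fixes op :: "'i \<Rightarrow> 'a \<Rightarrow> 'a \<Rightarrow> 'a"
  assumes racks: "rack (X \<alpha>) (op \<alpha>)"
    and connecting_hom:
      "\<beta> \<le> \<alpha> \<Longrightarrow> x \<in> X \<alpha> \<Longrightarrow> y \<in> X \<alpha> \<Longrightarrow>
        \<phi> \<alpha> \<beta> (op \<alpha> x y) = op \<beta> (\<phi> \<alpha> \<beta> x) (\<phi> \<alpha> \<beta> y)"

definition plonka_sum ::
  "('i::semilattice_inf \<Rightarrow> 'a set) \<Rightarrow> ('i \<Rightarrow> 'i \<Rightarrow> 'a \<Rightarrow> 'a) \<Rightarrow> ('i \<Rightarrow> 'a \<Rightarrow> 'a \<Rightarrow> 'a) \<Rightarrow> 'a \<Rightarrow> 'a \<Rightarrow> 'a" where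
  "plonka_sum X \<phi> op a b =
    (let \<alpha> = component_index X a; \<beta> = component_index X b
     in op (inf \<alpha> \<beta>) (\<phi> \<alpha> (inf \<alpha> \<beta>) a) (\<phi> \<beta> (inf \<alpha> \<beta>) b))"

locale solution_system = semilattice_system X \<phi>
  for X :: "'i::semilattice_inf \<Rightarrow> 'a set" and \<phi> :: "'i \<Rightarrow> 'i \<Rightarrow> 'a \<Rightarrow> 'a" +
  fixes \<rho> :: "'i \<Rightarrow> 'a \<times> 'a \<Rightarrow> 'a \<times> 'a"
  assumes solutions: "solution (X \<alpha>) (\<rho> \<alpha>)"
    and connecting_compat:
      "\<beta> \<le> \<alpha> \<Longrightarrow> p \<in> X \<alpha> \<times> X \<alpha> \<Longrightarrow>
        map_prod (\<phi> \<alpha> \<beta>) (\<phi> \<alpha> \<beta>) (\<rho> \<alpha> p) = \<rho> \<beta> (map_prod (\<phi> \<alpha> \<beta>) (\<phi> \<alpha> \<beta>) p)"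

definition strong_semilattice ::
  "('i::semilattice_inf \<Rightarrow> 'a set) \<Rightarrow> ('i \<Rightarrow> 'i \<Rightarrow> 'a \<Rightarrow> 'a) \<Rightarrow>
   ('i \<Rightarrow> 'a \<times> 'a \<Rightarrow> 'a \<times> 'a) \<Rightarrow> 'a \<times> 'a \<Rightarrow> 'a \<times> 'a" where
  "strong_semilattice X \<phi> \<rho> = (\<lambda>(a, b).
    let \<alpha> = component_index X a; \<beta> = component_index X b
    in \<rho> (inf \<alpha> \<beta>) (\<phi> \<alpha> (inf \<alpha> \<beta>) a, \<phi> \<beta> (inf \<alpha> \<beta>) b))"

end

theory Submission
  imports Defs
begin

text \<open>
  The whole content is the formula \<open>L\<^sup>0\<^sub>a b = \<phi>\<^bsub>\<beta>,\<alpha>\<beta>\<^esub> b\<close> for \<open>a \<in> X\<^sub>\<alpha>\<close>, \<open>b \<in> X\<^sub>\<beta>\<close>. Left translation by \<open>a\<close>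
  drops \<open>b\<close> into \<open>X\<^bsub>\<alpha>\<beta>\<^esub>\<close> and acts there by the permutation \<open>L\<close> of the element \<open>\<phi>\<^bsub>\<alpha>,\<alpha>\<beta>\<^esub> a\<close>. Its
  relative inverse therefore drops \<open>b\<close> into the same component and applies \<open>L\<^sup>-\<^sup>1\<close> there
  (\<open>relative_inverse_left_translation\<close>): once inside \<open>X\<^bsub>\<alpha>\<beta>\<^esub>\<close>, meeting with \<open>\<alpha>\<close> again changes
  nothing, so the composite of the two in either order is just the drop \<open>\<phi>\<^bsub>\<beta>,\<alpha>\<beta>\<^esub>\<close>. Substituting this in
  \<open>r(a, b) = (L\<^sup>0\<^sub>a b, L\<^sub>b a)\<close> gives the derived solution of \<open>X\<^bsub>\<alpha>\<beta>\<^esub>\<close> at the images of \<open>a\<close> and \<open>b\<close>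
  (\<open>associated_solution_plonka_sum\<close>).

  That the resulting map satisfies the Yang--Baxter equation holds for strong semilattices of
  arbitrary solutions (\<open>solution_strong_semilattice\<close>): on \<open>X\<^sub>\<alpha> \<times> X\<^sub>\<beta> \<times> X\<^sub>\<gamma>\<close> each side of the equation
  ends in \<open>X\<^bsub>\<alpha>\<beta>\<gamma>\<^esub>\<close>, and since the connecting maps commute with the solutions, each side agrees with the
  corresponding side for \<open>r\<^bsub>\<alpha>\<beta>\<gamma>\<^esub>\<close> at the images of the three arguments.
\<close>

section \<open>Relative inverses\<close>

text \<open>
  The standard uniqueness of group inverses in a semigroup: the idempotents \<open>f g\<close> and \<open>f h\<close>
  have the same image and kernel as \<open>f\<close>, so they coincide, and then
  \<open>g = g f g = f h g = h f g = h f h = h\<close>.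
\<close>

lemma relative_inverse_unique:
  assumes f: "f \<in> S \<rightarrow> S"
    and g: "is_relative_inverse S f g" and h: "is_relative_inverse S f h"
  shows "g = h"
proof -
  have gE: "g \<in> S \<rightarrow>\<^sub>E S" and hE: "h \<in> S \<rightarrow>\<^sub>E S"
    using g h by (auto simp: is_relative_inverse_def)
  have fS: "f y \<in> S" and gS: "g y \<in> S" and hS: "h y \<in> S" if "y \<in> S" for y
    using that f gE hE by (auto simp: PiE_iff)
  have G: "f (g (f y)) = f y" "g (f (g y)) = g y" "f (g y) = g (f y)"
    and H: "f (h (f y)) = f y" "h (f (h y)) = h y" "f (h y) = h (f y)" if "y \<in> S" for y
    using that g h by (auto simp: is_relative_inverse_def)
  have fg_fh: "f (g y) = f (h y)" if y: "y \<in> S" for y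
  proof -
    have "f (g y) = g (f (h (f y)))" using y by (simp add: G H)
    also have "\<dots> = g (f (f (h y)))" using y by (simp add: H)
    also have "\<dots> = f (g (f (h y)))" using y by (simp add: G fS hS)
    also have "\<dots> = f (h y)" using y by (simp add: G hS)
    finally show ?thesis .
  qed
  have "g y = h y" if y: "y \<in> S" for y
  proof -
    have "g y = f (g (g y))" using G(2)[OF y] G(3)[OF gS[OF y]] by simp
    also have "\<dots> = h (f (g y))" using y by (simp only: fg_fh H(3) gS)
    also have "\<dots> = h y" using y by (simp only: fg_fh H(2))
    finally show ?thesis .
  qed
  then show ?thesis using gE hE by (metis PiE_ext)
qed

lemma relative_inverse_eqI:
  assumes "f \<in> S \<rightarrow> S" "is_relative_inverse S f g"
  shows "relative_inverse S f = g"
  unfolding relative_inverse_def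
  using assms relative_inverse_unique by (metis the_equality)

section \<open>Strong semilattices of solutions\<close>

lemma (in solution) closed:
  "p \<in> S \<times> S \<Longrightarrow> r p \<in> S \<times> S"
  using maps by blast

lemma solution_cong:
  assumes r: "solution S r" and eq: "\<And>p. p \<in> S \<times> S \<Longrightarrow> r' p = r p"
  shows "solution S r'"
proof
  interpret solution S r by (rule r)
  show "r' \<in> S \<times> S \<rightarrow> S \<times> S"
    using closed eq by auto
  fix t assume t: "t \<in> S \<times> S \<times> S"
  have cong12: "r12 r' s = r12 r s \<and> r12 r s \<in> S \<times> S \<times> S"
    and cong23: "r23 r' s = r23 r s \<and> r23 r s \<in> S \<times> S \<times> S" if s: "s \<in> S \<times> S \<times> S" for s
  proof -
    obtain x y z where xyz: "s = (x, y, z)" "x \<in> S" "y \<in> S" "z \<in> S"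
      using s by auto
    then have "r (x, y) \<in> S \<times> S" "r (y, z) \<in> S \<times> S"
      using closed by auto
    then show "r12 r' s = r12 r s \<and> r12 r s \<in> S \<times> S \<times> S"
      and "r23 r' s = r23 r s \<and> r23 r s \<in> S \<times> S \<times> S"
      using xyz by (auto simp: r12_def r23_def eq split: prod.splits)
  qed
  show "r12 r' (r23 r' (r12 r' t)) = r23 r' (r12 r' (r23 r' t))"
    using t yang_baxter by (simp add: cong12 cong23)
qed

lemma (in semilattice_system) connecting_in [intro]:
  "\<beta> \<le> \<alpha> \<Longrightarrow> x \<in> X \<alpha> \<Longrightarrow> \<phi> \<alpha> \<beta> x \<in> X \<beta>"
  using connecting_maps by blast

lemma (in semilattice_system) component_index_eq:
  assumes "a \<in> X \<alpha>"
  shows "component_index X a = \<alpha>"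
  unfolding component_index_def
proof (rule the_equality)
  show "\<beta> = \<alpha>" if "a \<in> X \<beta>" for \<beta>
    using that assms disjoint by (auto simp: disjoint_family_on_def)
qed (rule assms)

lemma (in semilattice_system) strong_semilattice_eq:
  assumes "a \<in> X \<alpha>" "b \<in> X \<beta>"
  shows "strong_semilattice X \<phi> \<rho> (a, b) = \<rho> (inf \<alpha> \<beta>) (\<phi> \<alpha> (inf \<alpha> \<beta>) a, \<phi> \<beta> (inf \<alpha> \<beta>) b)"
  using assms by (simp add: strong_semilattice_def component_index_eq)

lemma (in solution_system) strong_semilattice_in:
  assumes "a \<in> X \<alpha>" "b \<in> X \<beta>"
  shows "strong_semilattice X \<phi> \<rho> (a, b) \<in> X (inf \<alpha> \<beta>) \<times> X (inf \<alpha> \<beta>)"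
  unfolding strong_semilattice_eq[OF assms]
  using assms by (intro solution.closed[OF solutions]) auto

text \<open>
  Going down to a component below \<open>\<alpha>\<beta>\<close> may be done before or after applying the solution; this is
  what makes the intermediate components of a threefold composite irrelevant.
\<close>

lemma (in solution_system) connecting_strong_semilattice:
  assumes a: "a \<in> X \<alpha>" and b: "b \<in> X \<beta>" and \<delta>: "\<delta> \<le> inf \<alpha> \<beta>"
  shows "map_prod (\<phi> (inf \<alpha> \<beta>) \<delta>) (\<phi> (inf \<alpha> \<beta>) \<delta>) (strong_semilattice X \<phi> \<rho> (a, b)) =
    \<rho> \<delta> (\<phi> \<alpha> \<delta> a, \<phi> \<beta> \<delta> b)"
proof -
  have "(\<phi> \<alpha> (inf \<alpha> \<beta>) a, \<phi> \<beta> (inf \<alpha> \<beta>) b) \<in> X (inf \<alpha> \<beta>) \<times> X (inf \<alpha> \<beta>)"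
    using a b by auto
  then show ?thesis
    by (simp add: strong_semilattice_eq[OF a b] connecting_compat[OF \<delta>]
        connecting_comp[OF \<delta> _ a] connecting_comp[OF \<delta> _ b])
qed

lemma (in solution_system) solution_strong_semilattice:
  "solution (\<Union>\<alpha>. X \<alpha>) (strong_semilattice X \<phi> \<rho>)" (is "solution ?U ?R")
proof
  show "?R \<in> ?U \<times> ?U \<rightarrow> ?U \<times> ?U"
  proof
    fix p assume "p \<in> ?U \<times> ?U"
    then obtain a b \<alpha> \<beta> where p: "p = (a, b)" "a \<in> X \<alpha>" "b \<in> X \<beta>"
      by auto
    then show "?R p \<in> ?U \<times> ?U"
      using strong_semilattice_in[OF p(2,3)] by auto
  qed
  fix t assume "t \<in> ?U \<times> ?U \<times> ?U"
  then obtain a b c \<alpha> \<beta> \<gamma> where t: "t = (a, b, c)"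
    and a: "a \<in> X \<alpha>" and b: "b \<in> X \<beta>" and c: "c \<in> X \<gamma>"
    by auto
  define \<delta> where "\<delta> = inf \<alpha> (inf \<beta> \<gamma>)"
  define t' where "t' = (\<phi> \<alpha> \<delta> a, \<phi> \<beta> \<delta> b, \<phi> \<gamma> \<delta> c)"
  have le: "\<delta> \<le> \<alpha>" "\<delta> \<le> \<beta>" "\<delta> \<le> \<gamma>" "\<delta> \<le> inf \<alpha> \<beta>" "\<delta> \<le> inf \<beta> \<gamma>"
    by (simp_all add: \<delta>_def le_infI1 le_infI2)
  have t'_in: "t' \<in> X \<delta> \<times> X \<delta> \<times> X \<delta>"
    using a b c le by (auto simp: t'_def)
  have left: "r12 ?R (r23 ?R (r12 ?R t)) = r12 (\<rho> \<delta>) (r23 (\<rho> \<delta>) (r12 (\<rho> \<delta>) t'))"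
  proof -
    let ?\<epsilon> = "inf \<alpha> \<beta>"
    have meets: "inf ?\<epsilon> \<gamma> = \<delta>" "inf ?\<epsilon> \<delta> = \<delta>"
      using le by (auto simp: \<delta>_def inf.assoc inf.absorb2)
    obtain u v where uv: "?R (a, b) = (u, v)" by fastforce
    then have uv_in: "u \<in> X ?\<epsilon>" "v \<in> X ?\<epsilon>"
      using strong_semilattice_in[OF a b] by auto
    have uv': "\<rho> \<delta> (\<phi> \<alpha> \<delta> a, \<phi> \<beta> \<delta> b) = (\<phi> ?\<epsilon> \<delta> u, \<phi> ?\<epsilon> \<delta> v)"
      using connecting_strong_semilattice[OF a b le(4)] uv by simp
    obtain p q where pq: "?R (v, c) = (p, q)" by fastforce
    then have p: "p \<in> X \<delta>"
      using strong_semilattice_in[OF uv_in(2) c] by (auto simp: meets)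
    have pq': "\<rho> \<delta> (\<phi> ?\<epsilon> \<delta> v, \<phi> \<gamma> \<delta> c) = (p, q)"
      using strong_semilattice_eq[OF uv_in(2) c, of \<rho>] pq by (simp add: meets)
    have "?R (u, p) = \<rho> \<delta> (\<phi> ?\<epsilon> \<delta> u, p)"
      using strong_semilattice_eq[OF uv_in(1) p, of \<rho>] p by (simp add: meets connecting_id)
    then show ?thesis
      by (simp add: t t'_def r12_def r23_def uv uv' pq pq')
  qed
  have right: "r23 ?R (r12 ?R (r23 ?R t)) = r23 (\<rho> \<delta>) (r12 (\<rho> \<delta>) (r23 (\<rho> \<delta>) t'))"
  proof -
    let ?\<epsilon> = "inf \<beta> \<gamma>"
    have meets: "inf \<alpha> ?\<epsilon> = \<delta>" "inf \<delta> ?\<epsilon> = \<delta>"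
      using le by (auto simp: \<delta>_def inf.absorb1)
    obtain u v where uv: "?R (b, c) = (u, v)" by fastforce
    then have uv_in: "u \<in> X ?\<epsilon>" "v \<in> X ?\<epsilon>"
      using strong_semilattice_in[OF b c] by auto
    have uv': "\<rho> \<delta> (\<phi> \<beta> \<delta> b, \<phi> \<gamma> \<delta> c) = (\<phi> ?\<epsilon> \<delta> u, \<phi> ?\<epsilon> \<delta> v)"
      using connecting_strong_semilattice[OF b c le(5)] uv by simp
    obtain p q where pq: "?R (a, u) = (p, q)" by fastforce
    then have q: "q \<in> X \<delta>"
      using strong_semilattice_in[OF a uv_in(1)] by (auto simp: meets)
    have pq': "\<rho> \<delta> (\<phi> \<alpha> \<delta> a, \<phi> ?\<epsilon> \<delta> u) = (p, q)"
      using strong_semilattice_eq[OF a uv_in(1), of \<rho>] pq by (simp add: meets)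
    have "?R (q, v) = \<rho> \<delta> (q, \<phi> ?\<epsilon> \<delta> v)"
      using strong_semilattice_eq[OF q uv_in(2), of \<rho>] q by (simp add: meets connecting_id)
    then show ?thesis
      by (simp add: t t'_def r12_def r23_def uv uv' pq pq')
  qed
  show "r12 ?R (r23 ?R (r12 ?R t)) = r23 ?R (r12 ?R (r23 ?R t))"
    unfolding left right by (rule solution.yang_baxter[OF solutions t'_in])
qed

section \<open>Derived solutions\<close>

text \<open>
  Both sides of the Yang--Baxter equation send \<open>(x, y, z)\<close> to a triple starting with \<open>z\<close>,
  \<open>z \<triangleright> y\<close>; the third entries are \<open>z \<triangleright> (y \<triangleright> x)\<close> and \<open>(z \<triangleright> y) \<triangleright> (z \<triangleright> x)\<close>.
\<close>

lemma (in shelf) solution_derived_solution: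
  "solution S (derived_solution op)"
  by unfold_locales
    (auto simp: derived_solution_def r12_def r23_def closed self_distrib[symmetric])

lemma (in rack_system) solution_system_derived_solution:
  "solution_system X \<phi> (\<lambda>\<alpha>. derived_solution (op \<alpha>))"
proof (intro solution_system.intro solution_system_axioms.intro semilattice_system_axioms)
  show "solution (X \<alpha>) (derived_solution (op \<alpha>))" for \<alpha>
    using racks by (simp add: rack_def shelf.solution_derived_solution)
next
  fix \<alpha> \<beta> :: 'i and p :: "'a \<times> 'a"
  assume "\<beta> \<le> \<alpha>" "p \<in> X \<alpha> \<times> X \<alpha>"
  then show "map_prod (\<phi> \<alpha> \<beta>) (\<phi> \<alpha> \<beta>) (derived_solution (op \<alpha>) p) =
      derived_solution (op \<beta>) (map_prod (\<phi> \<alpha> \<beta>) (\<phi> \<alpha> \<beta>) p)"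
    by (cases p) (simp add: derived_solution_def connecting_hom)
qed

section \<open>Left translations of a Plonka sum\<close>

lemma (in rack_system) plonka_sum_eq:
  assumes "a \<in> X \<alpha>" "b \<in> X \<beta>"
  shows "plonka_sum X \<phi> op a b =
    op (inf \<alpha> \<beta>) (\<phi> \<alpha> (inf \<alpha> \<beta>) a) (\<phi> \<beta> (inf \<alpha> \<beta>) b)"
  using assms by (simp add: plonka_sum_def component_index_eq)

lemma (in rack_system) plonka_sum_in:
  assumes "a \<in> X \<alpha>" "b \<in> X \<beta>"
  shows "plonka_sum X \<phi> op a b \<in> X (inf \<alpha> \<beta>)"
  unfolding plonka_sum_eq[OF assms]
  using assms by (intro shelf.closed[OF rack.axioms(1)[OF racks]]) auto

text \<open>
  The relative inverse of a left translation: move to the common component and invert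
  there, where the translation is a permutation.
\<close>

definition left_division ::
  "('i::semilattice_inf \<Rightarrow> 'a set) \<Rightarrow> ('i \<Rightarrow> 'i \<Rightarrow> 'a \<Rightarrow> 'a) \<Rightarrow> ('i \<Rightarrow> 'a \<Rightarrow> 'a \<Rightarrow> 'a) \<Rightarrow> 'a \<Rightarrow> 'a \<Rightarrow> 'a" where
  "left_division X \<phi> op a = (\<lambda>b\<in>\<Union>\<alpha>. X \<alpha>.
    (let \<alpha> = component_index X a; \<beta> = component_index X b; \<delta> = inf \<alpha> \<beta>
     in inv_into (X \<delta>) (op \<delta> (\<phi> \<alpha> \<delta> a)) (\<phi> \<beta> \<delta> b)))"

lemma (in rack_system) left_division_eq:
  assumes "a \<in> X \<alpha>" "b \<in> X \<beta>"
  shows "left_division X \<phi> op a b =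
    inv_into (X (inf \<alpha> \<beta>)) (op (inf \<alpha> \<beta>) (\<phi> \<alpha> (inf \<alpha> \<beta>) a)) (\<phi> \<beta> (inf \<alpha> \<beta>) b)"
  using assms by (auto simp: left_division_def component_index_eq Let_def)

lemma (in rack_system) left_translation_bij:
  assumes "a \<in> X \<alpha>" "\<delta> \<le> \<alpha>"
  shows "bij_betw (op \<delta> (\<phi> \<alpha> \<delta> a)) (X \<delta>) (X \<delta>)"
  using assms by (auto intro!: rack.bij[OF racks])

lemma (in rack_system) left_division_in:
  assumes a: "a \<in> X \<alpha>" and b: "b \<in> X \<beta>"
  shows "left_division X \<phi> op a b \<in> X (inf \<alpha> \<beta>)"
proof -
  let ?\<delta> = "inf \<alpha> \<beta>"
  have "op ?\<delta> (\<phi> \<alpha> ?\<delta> a) ` X ?\<delta> = X ?\<delta>"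
    by (rule bij_betw_imp_surj_on[OF left_translation_bij[OF a]]) simp
  moreover have "\<phi> \<beta> ?\<delta> b \<in> X ?\<delta>"
    using b by auto
  ultimately show ?thesis
    unfolding left_division_eq[OF a b] by (simp add: inv_into_into)
qed

text \<open>
  The two cancellation laws rest on \<open>\<alpha>(\<alpha>\<beta>) = \<alpha>\<beta>\<close>: the second of the two maps stays in the
  component reached by the first and uses the same permutation of it.
\<close>

lemma (in rack_system) plonka_sum_left_division:
  assumes a: "a \<in> X \<alpha>" and b: "b \<in> X \<beta>"
  shows "plonka_sum X \<phi> op a (left_division X \<phi> op a b) = \<phi> \<beta> (inf \<alpha> \<beta>) b"
proof -
  let ?\<delta> = "inf \<alpha> \<beta>"
  note d = left_division_in[OF a b]
  have "plonka_sum X \<phi> op a (left_division X \<phi> op a b) =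
      op ?\<delta> (\<phi> \<alpha> ?\<delta> a) (left_division X \<phi> op a b)"
    using plonka_sum_eq[OF a d] connecting_id[OF d] by simp
  also have "\<dots> = \<phi> \<beta> ?\<delta> b"
    unfolding left_division_eq[OF a b]
    using b by (auto intro!: bij_betw_inv_into_right[OF left_translation_bij[OF a]])
  finally show ?thesis .
qed

lemma (in rack_system) left_division_plonka_sum:
  assumes a: "a \<in> X \<alpha>" and b: "b \<in> X \<beta>"
  shows "left_division X \<phi> op a (plonka_sum X \<phi> op a b) = \<phi> \<beta> (inf \<alpha> \<beta>) b"
proof -
  let ?\<delta> = "inf \<alpha> \<beta>"
  note d = plonka_sum_in[OF a b]
  have "left_division X \<phi> op a (plonka_sum X \<phi> op a b) =
      inv_into (X ?\<delta>) (op ?\<delta> (\<phi> \<alpha> ?\<delta> a)) (plonka_sum X \<phi> op a b)"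
    using left_division_eq[OF a d] connecting_id[OF d] by simp
  also have "\<dots> = \<phi> \<beta> ?\<delta> b"
    unfolding plonka_sum_eq[OF a b]
    using b by (auto intro!: bij_betw_inv_into_left[OF left_translation_bij[OF a]])
  finally show ?thesis .
qed

text \<open>
  Both composites being the drop into the common component, the remaining two laws say that
  neither map distinguishes an element from its image there.
\<close>

lemma (in rack_system) is_relative_inverse_left_division:
  assumes a: "a \<in> X \<alpha>"
  shows "is_relative_inverse (\<Union>\<alpha>. X \<alpha>) (plonka_sum X \<phi> op a) (left_division X \<phi> op a)"
    (is "is_relative_inverse ?U ?f ?g")
proof -
  have "?g \<in> ?U \<rightarrow>\<^sub>E ?U"
  proof (rule PiE_I)
    show "?g b \<in> ?U" if "b \<in> ?U" for b
      using that left_division_in[OF a] by blast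
  qed (simp add: left_division_def)
  moreover have "?f (?g (?f b)) = ?f b \<and> ?g (?f (?g b)) = ?g b \<and> ?f (?g b) = ?g (?f b)"
    if "b \<in> ?U" for b
  proof -
    obtain \<beta> where b: "b \<in> X \<beta>" using \<open>b \<in> ?U\<close> by blast
    let ?b = "\<phi> \<beta> (inf \<alpha> \<beta>) b"
    have b': "?b \<in> X (inf \<alpha> \<beta>)" using b by auto
    have "?f ?b = ?f b"
      using connecting_id[OF b'] by (simp add: plonka_sum_eq[OF a b] plonka_sum_eq[OF a b'])
    moreover have "?g ?b = ?g b"
      using connecting_id[OF b'] by (simp add: left_division_eq[OF a b] left_division_eq[OF a b'])
    ultimately show ?thesis
      by (simp add: plonka_sum_left_division[OF a b] left_division_plonka_sum[OF a b])
  qed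
  ultimately show ?thesis
    unfolding is_relative_inverse_def by blast
qed

lemma (in rack_system) plonka_sum_closed:
  assumes "a \<in> X \<alpha>"
  shows "plonka_sum X \<phi> op a \<in> (\<Union>\<alpha>. X \<alpha>) \<rightarrow> (\<Union>\<alpha>. X \<alpha>)"
proof
  fix b assume "b \<in> (\<Union>\<alpha>. X \<alpha>)"
  then obtain \<beta> where "b \<in> X \<beta>" by auto
  then show "plonka_sum X \<phi> op a b \<in> (\<Union>\<alpha>. X \<alpha>)"
    using plonka_sum_in[OF assms] by auto
qed

lemma (in rack_system) relative_inverse_left_translation:
  assumes "a \<in> X \<alpha>"
  shows "relative_inverse (\<Union>\<alpha>. X \<alpha>) (plonka_sum X \<phi> op a) = left_division X \<phi> op a"
  using plonka_sum_closed[OF assms] is_relative_inverse_left_division[OF assms]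
  by (rule relative_inverse_eqI)

text \<open>
  With \<open>L\<^sup>0\<^sub>a b = \<phi>\<^bsub>\<beta>,\<alpha>\<beta>\<^esub> b\<close> the pair \<open>(L\<^sup>0\<^sub>a b, L\<^sub>b a)\<close> has the form \<open>(y, y \<triangleright> x)\<close> in the rack \<open>X\<^bsub>\<alpha>\<beta>\<^esub>\<close>.
\<close>

lemma (in rack_system) associated_solution_plonka_sum:
  assumes a: "a \<in> X \<alpha>" and b: "b \<in> X \<beta>"
  shows "associated_solution (\<Union>\<alpha>. X \<alpha>) (plonka_sum X \<phi> op) (a, b) =
    derived_solution (op (inf \<alpha> \<beta>)) (\<phi> \<alpha> (inf \<alpha> \<beta>) a, \<phi> \<beta> (inf \<alpha> \<beta>) b)"
  by (simp add: associated_solution_def derived_solution_def L0_def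
      relative_inverse_left_translation[OF a] plonka_sum_left_division[OF a b]
      plonka_sum_eq[OF b a] inf.commute)

section \<open>The solution associated to a Plonka sum of racks\<close>

theorem theorem5p7:
  fixes X :: "'i::semilattice_inf \<Rightarrow> 'a set"
    and \<phi> :: "'i \<Rightarrow> 'i \<Rightarrow> 'a \<Rightarrow> 'a"
    and op :: "'i \<Rightarrow> 'a \<Rightarrow> 'a \<Rightarrow> 'a"
  assumes "rack_system X \<phi> op"
  defines "U \<equiv> (\<Union>\<alpha>. X \<alpha>)"
    and "tri \<equiv> plonka_sum X \<phi> op"
    and "\<rho> \<equiv> (\<lambda>\<alpha>. derived_solution (op \<alpha>))"
  shows "(\<forall>x\<in>U. \<exists>!g. is_relative_inverse U (tri x) g) \<and>
    solution_system X \<phi> \<rho> \<and>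
    solution U (associated_solution U tri) \<and>
    (\<forall>p\<in>U \<times> U. associated_solution U tri p = strong_semilattice X \<phi> \<rho> p) \<and>
    (\<forall>\<alpha> \<beta>. \<forall>a\<in>X \<alpha>. \<forall>b\<in>X \<beta>.
       associated_solution U tri (a, b) =
         \<rho> (inf \<alpha> \<beta>) (\<phi> \<alpha> (inf \<alpha> \<beta>) a, \<phi> \<beta> (inf \<alpha> \<beta>) b))"
proof -
  interpret rack_system X \<phi> op by fact
  interpret derived: solution_system X \<phi> \<rho>
    unfolding \<rho>_def by (rule solution_system_derived_solution)
  have unique: "\<exists>!g. is_relative_inverse U (tri x) g" if x: "x \<in> U" for x
  proof -
    obtain \<alpha> where x: "x \<in> X \<alpha>" using x by (auto simp: U_def)
    note inverse = is_relative_inverse_left_division[OF x]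
    show ?thesis
      unfolding U_def tri_def
      using inverse relative_inverse_unique[OF plonka_sum_closed[OF x] _ inverse]
      by (rule ex1I)
  qed
  have formula: "associated_solution U tri (a, b) =
      \<rho> (inf \<alpha> \<beta>) (\<phi> \<alpha> (inf \<alpha> \<beta>) a, \<phi> \<beta> (inf \<alpha> \<beta>) b)" if "a \<in> X \<alpha>" "b \<in> X \<beta>" for \<alpha> \<beta> a b
    unfolding U_def tri_def \<rho>_def using that by (rule associated_solution_plonka_sum)
  have eq: "associated_solution U tri p = strong_semilattice X \<phi> \<rho> p" if p: "p \<in> U \<times> U" for p
  proof -
    obtain a b \<alpha> \<beta> where "p = (a, b)" "a \<in> X \<alpha>" "b \<in> X \<beta>"
      using p by (auto simp: U_def)
    then show ?thesis by (simp add: formula strong_semilattice_eq)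
  qed
  have "solution U (strong_semilattice X \<phi> \<rho>)"
    unfolding U_def by (rule derived.solution_strong_semilattice)
  then have "solution U (associated_solution U tri)"
    using eq by (rule solution_cong)
  then show ?thesis
    using unique derived.solution_system_axioms eq formula by (intro conjI ballI allI)
qed

end
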